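(* Suppose $\Gamma\to\Delta$ is a sequent containing only NDT formulas in normal form, and $\pi$ is an ${\mathrm{LNDT}}$ proof (respectively, a tree-like ${\mathrm{LNDT}}$ proof) of $\Gamma\to\Delta$. Then $\Gamma\to\Delta$ has an ${\mathrm{LNDT}}^{\mathrm{NF}}$ proof (respectively, a tree-like ${\mathrm{LNDT}}^{\mathrm{NF}}$ proof) $\pi'$ of size polynomially bounded by the size of $\pi$.
   Context: A literal is a propositional variable $x$ or its negation $\overline x$. DT formulas: literals, and $(ApB)$ for DT formulas $A,B$ and literal $p$ ("if $p$ is false then $A$, else $B$"). NDT formulas: literals, $(ApB)$ for NDT formulas $A,B$ and literal $p$, and $(A\lor B)$ for NDT formulas $A,B$. An NDT formula is in normal form if it has the form $\bigvee_{i<n}A_i$ (a disjunction built with binary $\lor$, arbitrarily nested) where each $A_i$ is a DT formula (i.e. $\lor$-free). Formula size = number of atomic occurrences; proof size = sum of sizes of formulas. ${\mathrm{LNDT}}$: lines are sequents $\Gamma\to\Delta$ of NDT formulas ($\Gamma,\Delta$ multisets); initial sequents $p\to p$, $p,\overline p\to$, $\to p,\overline p$; rules contraction, weakening (left and right), cut (from $\Gamma\to\Delta,A$ and $A,\Gamma\to\Delta$ infer $\Gamma\to\Delta$), dec-l (from $A,\Gamma\to\Delta,p$ and $p,B,\Gamma\to\Delta$ infer $ApB,\Gamma\to\Delta$), dec-r (from $\Gamma\to\Delta,A,p$ and $p,\Gamma\to\Delta,B$ infer $\Gamma\to\Delta,ApB$), $\lor$-l (from $A,\Gamma\to\Delta$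 and $B,\Gamma\to\Delta$ infer $A\lor B,\Gamma\to\Delta$), $\lor$-r (from $\Gamma\to\Delta,A,B$ infer $\Gamma\to\Delta,A\lor B$). Proofs are dag-like unless tree-like is specified. ${\mathrm{LNDT}}^{\mathrm{NF}}$ is ${\mathrm{LNDT}}$ restricted to proofs all of whose sequents contain only NDT formulas in normal form. *)

theory Defs
  imports "HOL-Library.Multiset" "HOL-Computational_Algebra.Polynomial"
begin

datatype literal = Pos nat | Neg nat

fun compl :: "literal \<Rightarrow> literal" where
  "compl (Pos x) = Neg x"
| "compl (Neg x) = Pos x"

text \<open>
  The type of NDT formulas. \<open>Dec A p B\<close> is the decision formula \<open>(ApB)\<close>:
  if \<open>p\<close> is false then \<open>A\<close>, else \<open>B\<close>.
\<close>
datatype ndt = Lit literal | Dec ndt literal ndt | Or ndt ndt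

inductive is_DT :: "ndt \<Rightarrow> bool" where
  "is_DT (Lit p)"
| "is_DT A \<Longrightarrow> is_DT B \<Longrightarrow> is_DT (Dec A p B)"

text \<open>Disjunctions of DT formulas with arbitrary bracketing; a single DT formula is included.\<close>
inductive normal_form :: "ndt \<Rightarrow> bool" where
  "is_DT A \<Longrightarrow> normal_form A"
| "normal_form A \<Longrightarrow> normal_form B \<Longrightarrow> normal_form (Or A B)"

text \<open>Number of occurrences of atoms; the decision literal of \<open>Dec\<close> counts as one.\<close>
primrec formula_size :: "ndt \<Rightarrow> nat" where
  "formula_size (Lit p) = 1"
| "formula_size (Dec A p B) = formula_size A + 1 + formula_size B"
| "formula_size (Or A B) = formula_size A + formula_size B"

datatype sequent = Sequent (ante: "ndt multiset") (succ: "ndt multiset")  (infix "\<turnstile>" 50)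

definition sequent_size :: "sequent \<Rightarrow> nat" where
  "sequent_size S = (\<Sum>A\<in>#ante S + succ S. formula_size A)"

definition normal_form_sequent :: "sequent \<Rightarrow> bool" where
  "normal_form_sequent S \<longleftrightarrow> (\<forall>A\<in>#ante S + succ S. normal_form A)"

text \<open>\<open>LNDT_inference Ps S\<close>: \<open>S\<close> follows from the list of premises \<open>Ps\<close> by one LNDT inference;
  initial sequents are the inferences without premises.\<close>
inductive LNDT_inference :: "sequent list \<Rightarrow> sequent \<Rightarrow> bool" where
  init_id:  "LNDT_inference [] ({#Lit p#} \<turnstile> {#Lit p#})"
| init_l:   "LNDT_inference [] ({#Lit p, Lit (compl p)#} \<turnstile> {#})"
| init_r:   "LNDT_inference [] ({#} \<turnstile> {#Lit p, Lit (compl p)#})"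
| contr_l:  "LNDT_inference [add_mset A (add_mset A \<Gamma>) \<turnstile> \<Delta>] (add_mset A \<Gamma> \<turnstile> \<Delta>)"
| contr_r:  "LNDT_inference [\<Gamma> \<turnstile> add_mset A (add_mset A \<Delta>)] (\<Gamma> \<turnstile> add_mset A \<Delta>)"
| weak_l:   "LNDT_inference [\<Gamma> \<turnstile> \<Delta>] (add_mset A \<Gamma> \<turnstile> \<Delta>)"
| weak_r:   "LNDT_inference [\<Gamma> \<turnstile> \<Delta>] (\<Gamma> \<turnstile> add_mset A \<Delta>)"
| cut:      "LNDT_inference [\<Gamma> \<turnstile> add_mset A \<Delta>, add_mset A \<Gamma> \<turnstile> \<Delta>] (\<Gamma> \<turnstile> \<Delta>)"
| dec_l:    "LNDT_inference
               [add_mset A \<Gamma> \<turnstile> add_mset (Lit p) \<Delta>, add_mset (Lit p) (add_mset B \<Gamma>) \<turnstile> \<Delta>]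
               (add_mset (Dec A p B) \<Gamma> \<turnstile> \<Delta>)"
| dec_r:    "LNDT_inference
               [\<Gamma> \<turnstile> add_mset A (add_mset (Lit p) \<Delta>), add_mset (Lit p) \<Gamma> \<turnstile> add_mset B \<Delta>]
               (\<Gamma> \<turnstile> add_mset (Dec A p B) \<Delta>)"
| or_l:     "LNDT_inference [add_mset A \<Gamma> \<turnstile> \<Delta>, add_mset B \<Gamma> \<turnstile> \<Delta>] (add_mset (Or A B) \<Gamma> \<turnstile> \<Delta>)"
| or_r:     "LNDT_inference [\<Gamma> \<turnstile> add_mset A (add_mset B \<Delta>)] (\<Gamma> \<turnstile> add_mset (Or A B) \<Delta>)"

text \<open>The size of a proof, given the list of occurrences of sequents in it.\<close>
definition proof_size :: "sequent list \<Rightarrow> nat" where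
  "proof_size \<pi> = (\<Sum>S\<leftarrow>\<pi>. sequent_size S)"

text \<open>Dag-like proofs are sequences of sequents, in which a line may serve as a premise any
  number of times.\<close>
definition LNDT_proof :: "sequent list \<Rightarrow> sequent \<Rightarrow> bool" where
  "LNDT_proof \<pi> S \<longleftrightarrow> \<pi> \<noteq> [] \<and> last \<pi> = S \<and>
     (\<forall>i<length \<pi>. \<exists>Ps. set Ps \<subseteq> set (take i \<pi>) \<and> LNDT_inference Ps (\<pi> ! i))"

definition LNDT_NF_proof :: "sequent list \<Rightarrow> sequent \<Rightarrow> bool" where
  "LNDT_NF_proof \<pi> S \<longleftrightarrow> LNDT_proof \<pi> S \<and> (\<forall>T\<in>set \<pi>. normal_form_sequent T)"

text \<open>Tree-like proofs: each node carries a sequent, inferred from the sequents at its children.\<close>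
datatype proof_tree = Node (root: sequent) (subproofs: "proof_tree list")

fun tree_lines :: "proof_tree \<Rightarrow> sequent list" where
  "tree_lines (Node S ts) = S # concat (map tree_lines ts)"

fun LNDT_tree :: "proof_tree \<Rightarrow> bool" where
  "LNDT_tree (Node S ts) \<longleftrightarrow> LNDT_inference (map root ts) S \<and> (\<forall>t\<in>set ts. LNDT_tree t)"

definition LNDT_tree_proof :: "proof_tree \<Rightarrow> sequent \<Rightarrow> bool" where
  "LNDT_tree_proof t S \<longleftrightarrow> LNDT_tree t \<and> root t = S"

definition LNDT_NF_tree_proof :: "proof_tree \<Rightarrow> sequent \<Rightarrow> bool" where
  "LNDT_NF_tree_proof t S \<longleftrightarrow>
     LNDT_tree_proof t S \<and> (\<forall>T\<in>set (tree_lines t). normal_form_sequent T)"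

end

(*
  A decision on p of two disjunctions of DT formulas A_i and B_j is equivalent to the disjunction
  of all (A_i p 0) and (0 p B_j). Pushing disjunctions outwards in this way squares the size of a
  formula at worst, since the number of disjuncts never exceeds the number of atoms of the original
  formula. Translating a proof line by line, every rule except dec-l and dec-r is preserved, and
  these two become cuts against short normal form proofs relating C, (C p 0), (0 p C) and p.
  Each premise is used only once in the simulation of a rule, so tree-like proofs stay tree-like.
  By soundness no line of a proof is the empty sequent, so that the number of lines is bounded by
  the size of the proof.
*)
theory Submission
  imports Defs
begin

\<comment> \<open>Sizes and normal forms of formulas and sequents\<close>
inductive_simps is_DT_simps [simp]: "is_DT (Lit p)" "is_DT (Dec A p B)" "is_DT (Or A B)"
inductive_simps normal_form_simps [simp]:
  "normal_form (Lit p)" "normal_form (Dec A p B)" "normal_form (Or A B)"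

lemma formula_size_pos: "0 < formula_size A"
  by (induction A) auto

lemma sequent_size_simps [simp]:
  "sequent_size ({#} \<turnstile> {#}) = 0"
  "sequent_size (add_mset A \<Gamma> \<turnstile> \<Delta>) = formula_size A + sequent_size (\<Gamma> \<turnstile> \<Delta>)"
  "sequent_size (\<Gamma> \<turnstile> add_mset A \<Delta>) = formula_size A + sequent_size (\<Gamma> \<turnstile> \<Delta>)"
  by (auto simp: sequent_size_def)

lemma normal_form_sequent_simps [simp]:
  "normal_form_sequent ({#} \<turnstile> {#})"
  "normal_form_sequent (add_mset A \<Gamma> \<turnstile> \<Delta>) \<longleftrightarrow> normal_form A \<and> normal_form_sequent (\<Gamma> \<turnstile> \<Delta>)"
  "normal_form_sequent (\<Gamma> \<turnstile> add_mset A \<Delta>) \<longleftrightarrow> normal_form A \<and> normal_form_sequent (\<Gamma> \<turnstile> \<Delta>)"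
  by (auto simp: normal_form_sequent_def)

subsection \<open>Translation into normal form\<close>

fun map_disjuncts :: "(ndt \<Rightarrow> ndt) \<Rightarrow> ndt \<Rightarrow> ndt" where
  "map_disjuncts f (Or A B) = Or (map_disjuncts f A) (map_disjuncts f B)"
| "map_disjuncts f A = f A"

text \<open>The language has no constants; \<open>p\<close> and its complement serve as the constant false in the
  branches where they are evaluated.\<close>
definition guard_false :: "literal \<Rightarrow> ndt \<Rightarrow> ndt" where
  "guard_false p A = Dec A p (Lit (compl p))"

definition guard_true :: "literal \<Rightarrow> ndt \<Rightarrow> ndt" where
  "guard_true p A = Dec (Lit p) p A"

text \<open>The case distinction makes \<open>nf\<close> the identity on formulas that are in normal form already.\<close>
fun nf :: "ndt \<Rightarrow> ndt" where
  "nf (Lit p) = Lit p"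
| "nf (Or A B) = Or (nf A) (nf B)"
| "nf (Dec A p B) = (if is_DT A \<and> is_DT B then Dec A p B
     else Or (map_disjuncts (guard_false p) (nf A)) (map_disjuncts (guard_true p) (nf B)))"

fun disjunct_count :: "ndt \<Rightarrow> nat" where
  "disjunct_count (Or A B) = disjunct_count A + disjunct_count B"
| "disjunct_count A = 1"

lemma is_DT_guard [simp]:
  "is_DT (guard_false p A) \<longleftrightarrow> is_DT A" "is_DT (guard_true p A) \<longleftrightarrow> is_DT A"
  by (auto simp: guard_false_def guard_true_def)

lemma is_DT_imp [simp]:
  assumes "is_DT A"
  shows "normal_form A" "map_disjuncts f A = f A" "disjunct_count A = 1"
  using assms by (cases A; auto)+

lemma normal_form_map_disjuncts:
  assumes "\<And>D. is_DT D \<Longrightarrow> is_DT (f D)" "normal_form A"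
  shows "normal_form (map_disjuncts f A)"
  using assms(2) by (induction A) (auto simp: assms(1))

lemma map_disjuncts_id [simp]: "map_disjuncts (\<lambda>D. D) A = A"
  by (induction A) auto

lemma normal_form_nf [simp]: "normal_form (nf A)"
  by (induction A) (auto intro!: normal_form_map_disjuncts)

lemma nf_DT: "is_DT A \<Longrightarrow> nf A = A"
  by (cases A) auto

lemma nf_normal_form: "normal_form A \<Longrightarrow> nf A = A"
  by (induction A) (auto simp: nf_DT)

lemma disjunct_count_map_disjuncts:
  assumes "\<And>D. is_DT D \<Longrightarrow> is_DT (f D)" "normal_form A"
  shows "disjunct_count (map_disjuncts f A) = disjunct_count A"
  using assms(2) by (induction A) (auto simp: assms(1))

lemma disjunct_count_le_formula_size: "disjunct_count A \<le> formula_size A"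
  by (induction A) auto

text \<open>Guards keep DT formulas DT, so a decision adds the disjunct counts of its two branches
  instead of multiplying them. The bound is therefore the size of the original formula, not that of
  its translation, which is what keeps \<open>nf\<close> quadratic.\<close>

lemma disjunct_count_nf: "disjunct_count (nf A) \<le> formula_size A"
  by (induction A) (auto simp: disjunct_count_map_disjuncts)

text \<open>A guard costs two atoms per disjunct: the decision literal and the literal standing for
  false.\<close>

lemma formula_size_map_guard:
  assumes "normal_form A"
  shows "formula_size (map_disjuncts (guard_false p) A) = formula_size A + 2 * disjunct_count A"
    and "formula_size (map_disjuncts (guard_true p) A) = formula_size A + 2 * disjunct_count A"
  using assms by (induction A) (auto simp: guard_false_def guard_true_def)

text \<open>If the branches of a decision have sizes a and b, the guards cost at most 2a + 2b. The
  atom of the decision literal pays for this, since (a + 1 + b)^2 contains the terms 2a and 2b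
  besides a^2 and b^2.\<close>

lemma formula_size_nf: "formula_size (nf A) \<le> (formula_size A)\<^sup>2"
proof (induction A)
  case (Dec A p B)
  show ?case
  proof (cases "is_DT A \<and> is_DT B")
    case True
    then show ?thesis by (simp add: power2_eq_square)
  next
    case False
    then have "formula_size (nf (Dec A p B)) =
        formula_size (nf A) + 2 * disjunct_count (nf A) +
        (formula_size (nf B) + 2 * disjunct_count (nf B))"
      by (auto simp: formula_size_map_guard)
    also have "\<dots> \<le> (formula_size A)\<^sup>2 + 2 * formula_size A + ((formula_size B)\<^sup>2 + 2 * formula_size B)"
      using Dec disjunct_count_nf[of A] disjunct_count_nf[of B] by linarith
    also have "\<dots> \<le> (formula_size (Dec A p B))\<^sup>2"
      by (simp add: power2_eq_square algebra_simps)
    finally show ?thesis .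
  qed
qed (auto simp: power2_eq_square algebra_simps intro: trans_le_add1)

definition nf_sequent :: "sequent \<Rightarrow> sequent" where
  "nf_sequent S = (image_mset nf (ante S) \<turnstile> image_mset nf (succ S))"

lemma normal_form_nf_sequent [simp]: "normal_form_sequent (nf_sequent S)"
  by (auto simp: normal_form_sequent_def nf_sequent_def)

text \<open>This ensures that the translated proof ends in the given sequent itself.\<close>

lemma nf_sequent_normal_form: "normal_form_sequent S \<Longrightarrow> nf_sequent S = S"
  by (cases S) (auto simp: normal_form_sequent_def nf_sequent_def nf_normal_form
      intro!: multiset.map_ident_strong)

lemma sequent_size_nf_sequent: "sequent_size (nf_sequent S) \<le> (sequent_size S)\<^sup>2"
proof -
  have "(\<Sum>A\<in>#M. formula_size (nf A)) \<le> (\<Sum>A\<in>#M. formula_size A)\<^sup>2" for M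
  proof (induction M)
    case (add A M)
    then show ?case
      using formula_size_nf[of A] by (simp add: power2_sum)
  qed simp
  from this[of "ante S + succ S"] show ?thesis
    by (simp add: sequent_size_def nf_sequent_def image_mset.compositionality comp_def)
qed

subsection \<open>Derivations from premises\<close>

definition bounded_nf :: "nat \<Rightarrow> sequent \<Rightarrow> bool" where
  "bounded_nf w S \<longleftrightarrow> normal_form_sequent S \<and> sequent_size S \<le> w"

text \<open>\<open>derivation w Ps S k\<close>: a tree-like derivation of \<open>S\<close> in which every member of the list \<open>Ps\<close>
  is used exactly once, so that proofs of the premises can be plugged in without duplication, and
  which has at most \<open>k\<close> further lines, each in normal form and of size at most \<open>w\<close>.\<close>
inductive derivation :: "nat \<Rightarrow> sequent list \<Rightarrow> sequent \<Rightarrow> nat \<Rightarrow> bool" for w where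
  premise: "derivation w [S] S k"
| axiom: "LNDT_inference [] S \<Longrightarrow> bounded_nf w S \<Longrightarrow> 0 < k \<Longrightarrow> derivation w [] S k"
| unary: "LNDT_inference [T] S \<Longrightarrow> bounded_nf w S \<Longrightarrow> derivation w Ps T k \<Longrightarrow> k < l \<Longrightarrow>
    derivation w Ps S l"
| binary: "LNDT_inference [T, U] S \<Longrightarrow> bounded_nf w S \<Longrightarrow> derivation w Ps T k \<Longrightarrow>
    derivation w Qs U l \<Longrightarrow> k + l < m \<Longrightarrow> derivation w (Ps @ Qs) S m"

lemma derivation_mono: "derivation w Ps S k \<Longrightarrow> k \<le> l \<Longrightarrow> derivation w Ps S l"
  by (induction rule: derivation.induct) (auto intro: derivation.intros)

lemma bounded_nf_subset:
  assumes "bounded_nf w (\<Gamma>' \<turnstile> \<Delta>')" "\<Gamma> \<subseteq># \<Gamma>'" "\<Delta> \<subseteq># \<Delta>'"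
  shows "bounded_nf w (\<Gamma> \<turnstile> \<Delta>)"
proof -
  from assms(2,3) obtain \<Theta> \<Lambda> where "\<Gamma>' = \<Gamma> + \<Theta>" "\<Delta>' = \<Delta> + \<Lambda>"
    by (auto simp: mset_subset_eq_exists_conv)
  with assms(1) show ?thesis
    by (auto simp: bounded_nf_def normal_form_sequent_def sequent_size_def)
qed

text \<open>Every formula has at least one atom, so a sequent of size at most \<open>w\<close> has
  at most \<open>w\<close> formulas, and \<open>w\<close> weakenings suffice.\<close>

lemma derivation_weaken:
  assumes "derivation w Ps (\<Gamma> \<turnstile> \<Delta>) k" "\<Gamma> \<subseteq># \<Gamma>'" "\<Delta> \<subseteq># \<Delta>'" "bounded_nf w (\<Gamma>' \<turnstile> \<Delta>')"
  shows "derivation w Ps (\<Gamma>' \<turnstile> \<Delta>') (k + w)"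
proof -
  have left: "derivation w Ps (\<Theta> + \<Gamma> \<turnstile> \<Delta>) (k + size \<Theta>)" if "bounded_nf w (\<Theta> + \<Gamma> \<turnstile> \<Delta>)" for \<Theta>
    using that
  proof (induction \<Theta>)
    case (add A \<Theta>)
    from add.prems have "bounded_nf w (\<Theta> + \<Gamma> \<turnstile> \<Delta>)"
      by (auto simp: bounded_nf_def)
    with add show ?case
      by (auto intro: derivation.unary weak_l)
  qed (simp add: assms(1))
  have right: "derivation w Ps (\<Theta> + \<Gamma> \<turnstile> \<Lambda> + \<Delta>) (k + size \<Theta> + size \<Lambda>)"
    if "bounded_nf w (\<Theta> + \<Gamma> \<turnstile> \<Lambda> + \<Delta>)" for \<Theta> \<Lambda>
    using that
  proof (induction \<Lambda>)
    case empty
    then show ?case using left by simp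
  next
    case (add A \<Lambda>)
    from add.prems have "bounded_nf w (\<Theta> + \<Gamma> \<turnstile> \<Lambda> + \<Delta>)"
      by (auto simp: bounded_nf_def)
    with add show ?case
      by (auto intro: derivation.unary weak_r)
  qed
  have size_le: "size M \<le> (\<Sum>A\<in>#M. formula_size A)" for M
  proof (induction M)
    case (add A M)
    then show ?case using formula_size_pos[of A] by simp
  qed simp
  from assms(2,3) obtain \<Theta> \<Lambda> where eq: "\<Gamma>' = \<Theta> + \<Gamma>" "\<Delta>' = \<Lambda> + \<Delta>"
    by (auto simp: mset_subset_eq_exists_conv add.commute)
  have "size \<Theta> + size \<Lambda> \<le> w"
    using assms(4) size_le[of \<Theta>] size_le[of \<Lambda>]
    by (auto simp: eq bounded_nf_def sequent_size_def)
  with right[of \<Theta> \<Lambda>] assms(4) show ?thesis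
    by (auto simp: eq intro: derivation_mono)
qed

lemma derivation_axiom:
  assumes "LNDT_inference [] (\<Gamma> \<turnstile> \<Delta>)" "\<Gamma> \<subseteq># \<Gamma>'" "\<Delta> \<subseteq># \<Delta>'" "bounded_nf w (\<Gamma>' \<turnstile> \<Delta>')" "w < k"
  shows "derivation w [] (\<Gamma>' \<turnstile> \<Delta>') k"
proof -
  have "derivation w [] (\<Gamma> \<turnstile> \<Delta>) 1"
    using assms bounded_nf_subset by (auto intro: derivation.axiom)
  with assms have "derivation w [] (\<Gamma>' \<turnstile> \<Delta>') (1 + w)"
    by (intro derivation_weaken)
  then show ?thesis
    using assms(5) by (auto intro: derivation_mono)
qed

text \<open>Derived sequents may lack part of the context that the rule demands. Weakening supplies
  it at a cost of at most \<open>w\<close> lines per premise, and the strict inequality leaves room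
  for the conclusion. The separate equation for \<open>Rs\<close> lets the rule apply to lists not
  written as an append.\<close>

lemma derivation_binary:
  assumes "LNDT_inference [\<Gamma>\<^sub>1' \<turnstile> \<Delta>\<^sub>1', \<Gamma>\<^sub>2' \<turnstile> \<Delta>\<^sub>2'] S" "bounded_nf w S"
    and "derivation w Ps (\<Gamma>\<^sub>1 \<turnstile> \<Delta>\<^sub>1) k" "derivation w Qs (\<Gamma>\<^sub>2 \<turnstile> \<Delta>\<^sub>2) l"
    and "\<Gamma>\<^sub>1 \<subseteq># \<Gamma>\<^sub>1'" "\<Delta>\<^sub>1 \<subseteq># \<Delta>\<^sub>1'" "bounded_nf w (\<Gamma>\<^sub>1' \<turnstile> \<Delta>\<^sub>1')"
    and "\<Gamma>\<^sub>2 \<subseteq># \<Gamma>\<^sub>2'" "\<Delta>\<^sub>2 \<subseteq># \<Delta>\<^sub>2'" "bounded_nf w (\<Gamma>\<^sub>2' \<turnstile> \<Delta>\<^sub>2')"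
    and "k + l + 2 * w < m" "Rs = Ps @ Qs"
  shows "derivation w Rs S m"
  unfolding assms(12) using assms(3-11)
  by (intro derivation.binary[OF assms(1,2), of Ps "k + w" Qs "l + w"] derivation_weaken) auto

section \<open>Short normal form proofs of identities\<close>

lemma derivation_literal: "0 < k \<Longrightarrow> 2 \<le> w \<Longrightarrow> derivation w [] ({#Lit p#} \<turnstile> {#Lit p#}) k"
  by (auto intro!: derivation.axiom init_id simp: bounded_nf_def)

text \<open>Two applications of dec-r to the identities for \<open>A\<close>, \<open>B\<close> and
  \<open>p\<close> give the two premises of a dec-l. With weakenings and literal axioms this adds at
  most 10w + 1 lines per decision, hence the factor 11. The factor 3 in the hypothesis makes room
  for the contexts of the intermediate sequents.\<close>

lemma derivation_identity_DT:
  assumes "is_DT A" "3 * formula_size A \<le> w"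
  shows "derivation w [] ({#A#} \<turnstile> {#A#}) (formula_size A * (11 * w))"
  using assms
proof (induction A)
  case (1 p)
  then show ?case
    by (auto intro!: derivation_literal)
next
  case (2 A B p)
  let ?D = "Dec A p B"
  from 2 have IH: "derivation w [] ({#A#} \<turnstile> {#A#}) (formula_size A * (11 * w))"
    "derivation w [] ({#B#} \<turnstile> {#B#}) (formula_size B * (11 * w))"
    and ax: "derivation w [] ({#Lit p#} \<turnstile> {#Lit p#}) w" and w: "3 \<le> w"
    by (auto intro!: derivation_literal)
  have *: "derivation w [] ({#A#} \<turnstile> {#?D, Lit p#}) (formula_size A * (11 * w) + 4 * w)"
    using 2(1,2,5) w
    by (intro derivation_binary[OF dec_r _ IH(1) ax]) (auto simp: bounded_nf_def subseteq_mset_def)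
  have **: "derivation w [] ({#Lit p, B#} \<turnstile> {#?D#}) (4 * w + formula_size B * (11 * w))"
    using 2(1,2,5) w
    by (intro derivation_binary[OF dec_r _ ax IH(2)]) (auto simp: bounded_nf_def subseteq_mset_def)
  show ?case
    using 2(1,2,5) w
    by (intro derivation_binary[OF dec_l _ * **])
       (auto simp: bounded_nf_def subseteq_mset_def algebra_simps)
qed

section \<open>Lifting proofs from single disjuncts to whole disjunctions\<close>

lemma disjunct_count_pos: "0 < disjunct_count A"
  by (induction A) auto

text \<open>The disjunction is taken apart by or-l. A binary tree with c leaves has c - 1 inner
  nodes; each leaf costs \<open>K\<close>, and \<open>K\<close> also exceeds the rule line and
  weakenings at an inner node.\<close>

lemma derivation_map_disjuncts_left:
  assumes "normal_form A" and "\<And>D. is_DT D \<Longrightarrow> is_DT (f D)"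
    and "\<And>D. is_DT D \<Longrightarrow> formula_size D \<le> formula_size A \<Longrightarrow>
      derivation w [] (add_mset (f D) \<Gamma> \<turnstile> \<Delta>) K"
    and "bounded_nf w (add_mset (map_disjuncts f A) \<Gamma> \<turnstile> \<Delta>)" "3 * w + 1 < K"
  shows "derivation w [] (add_mset (map_disjuncts f A) \<Gamma> \<turnstile> \<Delta>) ((2 * disjunct_count A - 1) * K)"
  using assms(1,3,4)
proof (induction A)
  case (1 A)
  then show ?case by auto
next
  case (2 A B)
  \<comment> \<open>Writing the counts as successors removes the truncated subtraction from the
    bounds.\<close>
  obtain a b where ab: "disjunct_count A = Suc a" "disjunct_count B = Suc b"
    using disjunct_count_pos by (metis gr0_conv_Suc)
  have nf: "normal_form (map_disjuncts f A)" "normal_form (map_disjuncts f B)"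
    using 2(1,2) assms(2) by (auto intro: normal_form_map_disjuncts)
  have *: "derivation w [] (add_mset (map_disjuncts f A) \<Gamma> \<turnstile> \<Delta>) ((2 * disjunct_count A - 1) * K)"
    using 2(6) nf by (intro 2(3,5)) (auto simp: bounded_nf_def)
  have **: "derivation w [] (add_mset (map_disjuncts f B) \<Gamma> \<turnstile> \<Delta>) ((2 * disjunct_count B - 1) * K)"
    using 2(6) nf by (intro 2(4,5)) (auto simp: bounded_nf_def)
  show ?case
    unfolding map_disjuncts.simps using 2(6) nf assms(5)
    by (intro derivation_binary[OF or_l _ * **]) (auto simp: bounded_nf_def ab algebra_simps)
qed

text \<open>A map on either side covers both introduction and elimination of guards: one map is the
  guard, the other the identity.\<close>

lemma derivation_map_disjuncts:
  assumes "normal_form A" and "\<And>D. is_DT D \<Longrightarrow> is_DT (f D)" "\<And>D. is_DT D \<Longrightarrow> is_DT (g D)"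
    and "\<And>D. is_DT D \<Longrightarrow> formula_size D \<le> formula_size A \<Longrightarrow>
      derivation w [] (add_mset (f D) \<Gamma> \<turnstile> add_mset (g D) \<Delta>) K"
    and "bounded_nf w (add_mset (map_disjuncts f A) \<Gamma> \<turnstile> add_mset (map_disjuncts g A) \<Delta>)"
    and "3 * w + 1 < K"
  shows "derivation w [] (add_mset (map_disjuncts f A) \<Gamma> \<turnstile> add_mset (map_disjuncts g A) \<Delta>)
    ((2 * disjunct_count A - 1) * K)"
  using assms(1,4,5)
proof (induction A)
  case (1 A)
  then show ?case by auto
next
  case (2 A B)
  obtain a b where ab: "disjunct_count A = Suc a" "disjunct_count B = Suc b"
    using disjunct_count_pos by (metis gr0_conv_Suc)
  have nf: "normal_form (map_disjuncts h C)" if "h \<in> {f, g}" "C \<in> {A, B}" for h C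
    using that 2(1,2) assms(2,3) by (auto intro!: normal_form_map_disjuncts)
  have *: "derivation w [] (add_mset (map_disjuncts f A) \<Gamma> \<turnstile> add_mset (map_disjuncts g A) \<Delta>)
      ((2 * disjunct_count A - 1) * K)"
    using 2(6) nf by (intro 2(3,5)) (auto simp: bounded_nf_def)
  have **: "derivation w [] (add_mset (map_disjuncts f B) \<Gamma> \<turnstile> add_mset (map_disjuncts g B) \<Delta>)
      ((2 * disjunct_count B - 1) * K)"
    using 2(6) nf by (intro 2(4,5)) (auto simp: bounded_nf_def)
  \<comment> \<open>The two branches end in different succedents. Weakening gives both of them both
    mapped disjuncts, so that or-l applies; or-r then joins the disjuncts.\<close>
  have "derivation w [] (add_mset (Or (map_disjuncts f A) (map_disjuncts f B)) \<Gamma> \<turnstile>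
      add_mset (map_disjuncts g A) (add_mset (map_disjuncts g B) \<Delta>))
      ((2 * disjunct_count A - 1) * K + (2 * disjunct_count B - 1) * K + 2 * w + 1)"
    using 2(6) nf
    by (intro derivation_binary[OF or_l _ * **])
       (auto simp: bounded_nf_def subseteq_mset_def algebra_simps)
  then show ?case
    unfolding map_disjuncts.simps using 2(6) nf assms(6)
    by (elim derivation.unary[OF or_r, rotated]) (auto simp: bounded_nf_def ab algebra_simps)
qed

text \<open>Semantically \<open>F A\<close> is the conjunction of \<open>A\<close> with the
  complement of \<open>p\<close>, and \<open>T A\<close> that of \<open>A\<close> with
  \<open>p\<close>; the six sequents are the elimination and introduction laws of these
  conjunctions. For a single disjunct each takes one decision rule, whose premises weaken an
  identity or a contradiction of literals.\<close>

lemma derivation_guards: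
  fixes p :: literal
  defines "F \<equiv> map_disjuncts (guard_false p)" and "T \<equiv> map_disjuncts (guard_true p)"
  assumes "normal_form A" "8 * formula_size A \<le> w"
  shows guard_false_elim: "derivation w [] ({#F A#} \<turnstile> {#A#}) (40 * w ^ 3)"
    and guard_false_literal: "derivation w [] ({#F A, Lit p#} \<turnstile> {#}) (40 * w ^ 3)"
    and guard_false_intro: "derivation w [] ({#A#} \<turnstile> {#F A, Lit p#}) (40 * w ^ 3)"
    and guard_true_elim: "derivation w [] ({#T A#} \<turnstile> {#A#}) (40 * w ^ 3)"
    and guard_true_literal: "derivation w [] ({#T A#} \<turnstile> {#Lit p#}) (40 * w ^ 3)"
    and guard_true_intro: "derivation w [] ({#A, Lit p#} \<turnstile> {#T A#}) (40 * w ^ 3)"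
proof -
  \<comment> \<open>One disjunct costs at most 11w^2 lines for its identity and fewer than w^2 for
    literals, weakenings and the rule itself. As there are at most \<open>w\<close> disjuncts, the
    total is at most 2w times \<open>?K\<close>.\<close>
  let ?K = "20 * w\<^sup>2"
  have w: "8 \<le> w"
    using assms(4) formula_size_pos[of A] by linarith
  then have ww: "8 * w \<le> w\<^sup>2"
    by (simp add: power2_eq_square)
  have K: "3 * w + 1 < ?K"
    using w ww by linarith
  have "(2 * disjunct_count A - 1) * ?K \<le> (2 * w) * ?K"
    using assms(4) disjunct_count_le_formula_size[of A] by (intro mult_right_mono) auto
  also have "\<dots> = 40 * w ^ 3"
    by (simp add: power2_eq_square power3_eq_cube)
  finally have le: "(2 * disjunct_count A - 1) * ?K \<le> 40 * w ^ 3" .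
  have sizes: "formula_size (F A) \<le> 3 * formula_size A" "formula_size (T A) \<le> 3 * formula_size A"
    using disjunct_count_le_formula_size[of A] assms(3)
    by (auto simp: F_def T_def formula_size_map_guard)
  have nfs: "normal_form (F A)" "normal_form (T A)"
    using assms(3) by (auto simp: F_def T_def intro: normal_form_map_disjuncts)
  have id: "derivation w [] ({#D#} \<turnstile> {#D#}) (11 * w\<^sup>2)"
    if "is_DT D" "formula_size D \<le> formula_size A" for D
  proof -
    have "formula_size D * (11 * w) \<le> w * (11 * w)"
      using that assms(4) by (intro mult_right_mono) auto
    with derivation_identity_DT[of D w] that assms(4) show ?thesis
      by (auto simp: power2_eq_square intro: derivation_mono)
  qed
  have lit: "derivation w [] ({#Lit q#} \<turnstile> {#Lit q#}) w" for q
    using w by (intro derivation_literal) auto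
  have contra: "derivation w [] ({#Lit p, Lit (compl p)#} \<turnstile> {#}) w"
    using w by (auto intro!: derivation.axiom init_l simp: bounded_nf_def)

  have "derivation w [] ({#guard_false p D#} \<turnstile> {#D#}) ?K"
    if "is_DT D" "formula_size D \<le> formula_size A" for D
    using w ww that assms(4) unfolding guard_false_def
    by (intro derivation_binary[OF dec_l _ id contra])
       (auto simp: bounded_nf_def subseteq_mset_def)
  \<comment> \<open>The identity map leaves \<open>A\<close> unchanged, so this is the unguarded
    formula in the shape that the lifting lemma expects.\<close>
  then have "derivation w [] ({#F A#} \<turnstile> {#map_disjuncts (\<lambda>D. D) A#}) ((2 * disjunct_count A - 1) * ?K)"
    unfolding F_def using assms(3,4) nfs sizes K formula_size_pos[of A]
    by (intro derivation_map_disjuncts) (auto simp: bounded_nf_def F_def)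
  with le show "derivation w [] ({#F A#} \<turnstile> {#A#}) (40 * w ^ 3)"
    by (auto intro: derivation_mono)

  have "derivation w [] ({#guard_false p D, Lit p#} \<turnstile> {#}) ?K"
    if "is_DT D" "formula_size D \<le> formula_size A" for D
    using w ww that assms(4) unfolding guard_false_def
    by (intro derivation_binary[OF dec_l _ lit contra])
       (auto simp: bounded_nf_def subseteq_mset_def)
  then have "derivation w [] ({#F A, Lit p#} \<turnstile> {#}) ((2 * disjunct_count A - 1) * ?K)"
    unfolding F_def using assms(3,4) nfs sizes K formula_size_pos[of A]
    by (intro derivation_map_disjuncts_left) (auto simp: bounded_nf_def F_def)
  with le show "derivation w [] ({#F A, Lit p#} \<turnstile> {#}) (40 * w ^ 3)"
    by (auto intro: derivation_mono)

  have "derivation w [] ({#D#} \<turnstile> {#guard_false p D, Lit p#}) ?K"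
    if "is_DT D" "formula_size D \<le> formula_size A" for D
    using w ww that assms(4) unfolding guard_false_def
    by (intro derivation_binary[OF dec_r _ id lit])
       (auto simp: bounded_nf_def subseteq_mset_def)
  then have "derivation w [] ({#map_disjuncts (\<lambda>D. D) A#} \<turnstile> {#F A, Lit p#})
      ((2 * disjunct_count A - 1) * ?K)"
    unfolding F_def using assms(3,4) nfs sizes K formula_size_pos[of A]
    by (intro derivation_map_disjuncts) (auto simp: bounded_nf_def F_def)
  with le show "derivation w [] ({#A#} \<turnstile> {#F A, Lit p#}) (40 * w ^ 3)"
    by (auto intro: derivation_mono)

  have "derivation w [] ({#guard_true p D#} \<turnstile> {#D#}) ?K"
    if "is_DT D" "formula_size D \<le> formula_size A" for D
    using w ww that assms(4) unfolding guard_true_def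
    by (intro derivation_binary[OF dec_l _ lit id])
       (auto simp: bounded_nf_def subseteq_mset_def)
  then have "derivation w [] ({#T A#} \<turnstile> {#map_disjuncts (\<lambda>D. D) A#}) ((2 * disjunct_count A - 1) * ?K)"
    unfolding T_def using assms(3,4) nfs sizes K formula_size_pos[of A]
    by (intro derivation_map_disjuncts) (auto simp: bounded_nf_def T_def)
  with le show "derivation w [] ({#T A#} \<turnstile> {#A#}) (40 * w ^ 3)"
    by (auto intro: derivation_mono)

  have "derivation w [] ({#guard_true p D#} \<turnstile> {#Lit p#}) ?K"
    if "is_DT D" "formula_size D \<le> formula_size A" for D
    using w ww that assms(4) unfolding guard_true_def
    by (intro derivation_binary[OF dec_l _ lit lit])
       (auto simp: bounded_nf_def subseteq_mset_def)
  then have "derivation w [] ({#T A#} \<turnstile> {#Lit p#}) ((2 * disjunct_count A - 1) * ?K)"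
    unfolding T_def using assms(3,4) nfs sizes K formula_size_pos[of A]
    by (intro derivation_map_disjuncts_left) (auto simp: bounded_nf_def T_def)
  with le show "derivation w [] ({#T A#} \<turnstile> {#Lit p#}) (40 * w ^ 3)"
    by (auto intro: derivation_mono)

  have "derivation w [] ({#D, Lit p#} \<turnstile> {#guard_true p D#}) ?K"
    if "is_DT D" "formula_size D \<le> formula_size A" for D
    using w ww that assms(4) unfolding guard_true_def
    by (intro derivation_binary[OF dec_r _ lit id])
       (auto simp: bounded_nf_def subseteq_mset_def)
  then have "derivation w [] ({#map_disjuncts (\<lambda>D. D) A, Lit p#} \<turnstile> {#T A#})
      ((2 * disjunct_count A - 1) * ?K)"
    unfolding T_def using assms(3,4) nfs sizes K formula_size_pos[of A]
    by (intro derivation_map_disjuncts) (auto simp: bounded_nf_def T_def)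
  with le show "derivation w [] ({#A, Lit p#} \<turnstile> {#T A#}) (40 * w ^ 3)"
    by (auto intro: derivation_mono)
qed

section \<open>Simulation of the decision rules\<close>

context
  fixes A B :: ndt and \<Gamma> \<Delta> :: "ndt multiset" and p :: literal and w :: nat and F T
  defines "F \<equiv> map_disjuncts (guard_false p) A" and "T \<equiv> map_disjuncts (guard_true p) B"
  assumes nf: "normal_form A" "normal_form B" "normal_form_sequent (\<Gamma> \<turnstile> \<Delta>)"
    and w: "8 * formula_size A + 8 * formula_size B + sequent_size (\<Gamma> \<turnstile> \<Delta>) \<le> w"
begin

text \<open>Guards at most triple a formula, which bounds the width of all cuts below;
  \<open>w \<le> w ^ 3\<close> absorbs their weakenings into the cubic line counts.\<close>

private lemma facts:
  "8 \<le> w" "w \<le> w ^ 3"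
  "normal_form F" "normal_form T"
  "formula_size F \<le> 3 * formula_size A" "formula_size T \<le> 3 * formula_size B"
proof -
  show "8 \<le> w"
    using w formula_size_pos[of A] by linarith
  then show "w \<le> w ^ 3"
    by (intro self_le_power) auto
  show "normal_form F" "normal_form T"
    using nf by (auto simp: F_def T_def intro: normal_form_map_disjuncts)
  show "formula_size F \<le> 3 * formula_size A" "formula_size T \<le> 3 * formula_size B"
    using disjunct_count_le_formula_size[of A] disjunct_count_le_formula_size[of B] nf
    by (auto simp: F_def T_def formula_size_map_guard)
qed

text \<open>Cutting the first premise with F \<turnstile> A and then cutting away \<open>p\<close>
  with F, p \<turnstile> leaves \<open>F\<close> on the left. Cutting the second premise with T
  \<turnstile> B and then cutting away \<open>p\<close> with T \<turnstile> p leaves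
  \<open>T\<close>. Finally or-l joins the two.\<close>

lemma derivation_dec_l:
  "derivation w [add_mset A \<Gamma> \<turnstile> add_mset (Lit p) \<Delta>, add_mset (Lit p) (add_mset B \<Gamma>) \<turnstile> \<Delta>]
     (add_mset (Or F T) \<Gamma> \<turnstile> \<Delta>) (200 * w ^ 3)"
proof -
  have F_elim: "derivation w [] ({#F#} \<turnstile> {#A#}) (40 * w ^ 3)"
    and F_lit: "derivation w [] ({#F, Lit p#} \<turnstile> {#}) (40 * w ^ 3)"
    and T_elim: "derivation w [] ({#T#} \<turnstile> {#B#}) (40 * w ^ 3)"
    and T_lit: "derivation w [] ({#T#} \<turnstile> {#Lit p#}) (40 * w ^ 3)"
    using nf w unfolding F_def T_def by (intro derivation_guards; simp)+
  have 1: "derivation w [add_mset A \<Gamma> \<turnstile> add_mset (Lit p) \<Delta>] (add_mset F \<Gamma> \<turnstile> add_mset (Lit p) \<Delta>)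
      (44 * w ^ 3)"
    \<comment> \<open>The premise enters with line count 0, so the cost is that of
      \<open>F_elim\<close>, at most 2w weakenings and the cut.\<close>
    using facts nf w formula_size_pos[of A] formula_size_pos[of B]
    by (intro derivation_binary[OF cut _ F_elim premise[where k=0]])
       (auto simp: bounded_nf_def subseteq_mset_def)
  have 2: "derivation w [add_mset A \<Gamma> \<turnstile> add_mset (Lit p) \<Delta>] (add_mset F \<Gamma> \<turnstile> \<Delta>) (90 * w ^ 3)"
    using facts nf w formula_size_pos[of A] formula_size_pos[of B]
    by (intro derivation_binary[OF cut _ 1 F_lit])
       (auto simp: bounded_nf_def subseteq_mset_def)
  have 3: "derivation w [add_mset (Lit p) (add_mset B \<Gamma>) \<turnstile> \<Delta>]
      (add_mset (Lit p) (add_mset T \<Gamma>) \<turnstile> \<Delta>) (44 * w ^ 3)"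
    using facts nf w formula_size_pos[of A] formula_size_pos[of B]
    by (intro derivation_binary[OF cut _ T_elim premise[where k=0]])
       (auto simp: bounded_nf_def subseteq_mset_def)
  have 4: "derivation w [add_mset (Lit p) (add_mset B \<Gamma>) \<turnstile> \<Delta>] (add_mset T \<Gamma> \<turnstile> \<Delta>) (90 * w ^ 3)"
    using facts nf w formula_size_pos[of A] formula_size_pos[of B]
    by (intro derivation_binary[OF cut _ T_lit 3])
       (auto simp: bounded_nf_def subseteq_mset_def)
  show ?thesis
    using facts nf w formula_size_pos[of A] formula_size_pos[of B]
    by (intro derivation_binary[OF or_l _ 2 4])
       (auto simp: bounded_nf_def subseteq_mset_def)
qed

text \<open>Cuts with A \<turnstile> F, p and B, p \<turnstile> T replace \<open>A\<close> and
  \<open>B\<close> by \<open>F\<close> and \<open>T\<close> in the premises. A cut on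
  \<open>p\<close> merges the results, and or-r forms the disjunction.\<close>

lemma derivation_dec_r:
  "derivation w [\<Gamma> \<turnstile> add_mset A (add_mset (Lit p) \<Delta>), add_mset (Lit p) \<Gamma> \<turnstile> add_mset B \<Delta>]
     (\<Gamma> \<turnstile> add_mset (Or F T) \<Delta>) (200 * w ^ 3)"
proof -
  have F_intro: "derivation w [] ({#A#} \<turnstile> {#F, Lit p#}) (40 * w ^ 3)"
    and T_intro: "derivation w [] ({#B, Lit p#} \<turnstile> {#T#}) (40 * w ^ 3)"
    using nf w unfolding F_def T_def by (intro derivation_guards; simp)+
  have 1: "derivation w [\<Gamma> \<turnstile> add_mset A (add_mset (Lit p) \<Delta>)] (\<Gamma> \<turnstile> add_mset F (add_mset (Lit p) \<Delta>))
      (44 * w ^ 3)"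
    using facts nf w formula_size_pos[of A] formula_size_pos[of B]
    by (intro derivation_binary[OF cut _ premise[where k=0] F_intro])
       (auto simp: bounded_nf_def subseteq_mset_def)
  have 2: "derivation w [add_mset (Lit p) \<Gamma> \<turnstile> add_mset B \<Delta>] (add_mset (Lit p) \<Gamma> \<turnstile> add_mset T \<Delta>)
      (44 * w ^ 3)"
    using facts nf w formula_size_pos[of A] formula_size_pos[of B]
    by (intro derivation_binary[OF cut _ premise[where k=0] T_intro])
       (auto simp: bounded_nf_def subseteq_mset_def)
  have 3: "derivation w [\<Gamma> \<turnstile> add_mset A (add_mset (Lit p) \<Delta>), add_mset (Lit p) \<Gamma> \<turnstile> add_mset B \<Delta>]
      (\<Gamma> \<turnstile> add_mset F (add_mset T \<Delta>)) (99 * w ^ 3)"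
    using facts nf w formula_size_pos[of A] formula_size_pos[of B]
    by (intro derivation_binary[OF cut _ 1 2])
       (auto simp: bounded_nf_def subseteq_mset_def)
  show ?thesis
    using facts nf w formula_size_pos[of A] formula_size_pos[of B]
    by (intro derivation.unary[OF or_r _ 3]) (auto simp: bounded_nf_def)
qed

end

text \<open>Translation squares sizes, so translated sequents take at most a twentieth of
  \<open>w\<close>. All rules but the decision rules commute with \<open>nf\<close> and are
  simulated by themselves.\<close>

lemma derivation_nf_sequent:
  assumes "LNDT_inference Ps S" "\<And>T. T \<in> set (S # Ps) \<Longrightarrow> sequent_size T \<le> n" "0 < n"
    and w: "w = 20 * n\<^sup>2"
  shows "derivation w (map nf_sequent Ps) (nf_sequent S) (200 * w ^ 3)"
proof -
  have w20: "20 \<le> w"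
    using assms(3) by (simp add: w)
  moreover have "w \<le> w ^ 3"
    using w20 by (intro self_le_power) auto
  ultimately have k: "2 < 200 * w ^ 3"
    by linarith
  have size: "20 * sequent_size (nf_sequent T) \<le> w" if "T \<in> set (S # Ps)" for T
    using sequent_size_nf_sequent[of T] power_mono[OF assms(2)[OF that], of 2]
    unfolding w by linarith
  have S: "bounded_nf w (nf_sequent S)"
    using size[of S] by (simp add: bounded_nf_def)
  have initial: "derivation w [] R (200 * w ^ 3)"
    if "LNDT_inference [] R" "bounded_nf w R" for R
    using that k w20 by (intro derivation.axiom) auto
  have single: "derivation w [T] R (200 * w ^ 3)"
    if "LNDT_inference [T] R" "bounded_nf w R" for T R
    using that k by (intro derivation.unary[OF _ _ premise[where k=0]]) linarith+
  have double: "derivation w [T, U] R (200 * w ^ 3)"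
    if "LNDT_inference [T, U] R" "bounded_nf w R" for T U R
    using derivation.binary[OF that premise[where k=0] premise[where k=0]] k w20 by simp
  note [simp] = nf_sequent_def
  show ?thesis
    using assms(1)
  proof cases
    case init_id
    with S show ?thesis by (auto intro!: initial LNDT_inference.init_id)
  next
    case init_l
    with S show ?thesis by (auto intro!: initial LNDT_inference.init_l)
  next
    case init_r
    with S show ?thesis by (auto intro!: initial LNDT_inference.init_r)
  next
    case contr_l
    with S show ?thesis by (auto intro!: single LNDT_inference.contr_l)
  next
    case contr_r
    with S show ?thesis by (auto intro!: single LNDT_inference.contr_r)
  next
    case weak_l
    with S show ?thesis by (auto intro!: single LNDT_inference.weak_l)
  next
    case weak_r
    with S show ?thesis by (auto intro!: single LNDT_inference.weak_r)
  next
    case cut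
    with S show ?thesis by (auto intro!: double LNDT_inference.cut)
  next
    case (dec_l A \<Gamma> p \<Delta> B)
    show ?thesis
    proof (cases "is_DT A \<and> is_DT B")
      case True
      \<comment> \<open>Here \<open>nf\<close> changes neither the decision nor its branches, so the
        rule itself applies.\<close>
      with dec_l S show ?thesis by (auto simp: nf_DT intro!: double LNDT_inference.dec_l)
    next
      case False
      \<comment> \<open>The translated \<open>A\<close> and \<open>B\<close> lie in the first and
        the second premise, so 8 times each plus the context is at most 17/20 of
        \<open>w\<close>.\<close>
      with dec_l size[of S] size[of "hd Ps"] size[of "Ps ! 1"] show ?thesis
        by (auto intro!: derivation_dec_l simp: normal_form_sequent_def)
    qed
  next
    case (dec_r \<Gamma> A p \<Delta> B)
    show ?thesis
    proof (cases "is_DT A \<and> is_DT B")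
      case True
      with dec_r S show ?thesis by (auto simp: nf_DT intro!: double LNDT_inference.dec_r)
    next
      case False
      with dec_r size[of S] size[of "hd Ps"] size[of "Ps ! 1"] show ?thesis
        by (auto intro!: derivation_dec_r simp: normal_form_sequent_def)
    qed
  next
    case or_l
    with S show ?thesis by (auto intro!: double LNDT_inference.or_l)
  next
    case or_r
    with S show ?thesis by (auto intro!: single LNDT_inference.or_r)
  qed
qed

subsection \<open>Soundness\<close>

text \<open>The valuation that makes all variables true is enough to exclude empty sequents.\<close>
fun lit_holds :: "literal \<Rightarrow> bool" where
  "lit_holds (Pos x) = True"
| "lit_holds (Neg x) = False"

primrec holds :: "ndt \<Rightarrow> bool" where
  "holds (Lit p) = lit_holds p"
| "holds (Dec A p B) = (if lit_holds p then holds B else holds A)"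
| "holds (Or A B) \<longleftrightarrow> holds A \<or> holds B"

fun sequent_holds :: "sequent \<Rightarrow> bool" where
  "sequent_holds (\<Gamma> \<turnstile> \<Delta>) \<longleftrightarrow> ((\<forall>A\<in>#\<Gamma>. holds A) \<longrightarrow> (\<exists>A\<in>#\<Delta>. holds A))"

lemma lit_holds_compl [simp]: "lit_holds (compl p) \<longleftrightarrow> \<not> lit_holds p"
  by (cases p) auto

lemma LNDT_inference_sound:
  "LNDT_inference Ps S \<Longrightarrow> \<forall>T\<in>set Ps. sequent_holds T \<Longrightarrow> sequent_holds S"
  by (induction rule: LNDT_inference.induct) (auto split: if_splits)

text \<open>The empty sequent is false, so a true sequent contains a formula and hence an
  atom.\<close>

lemma sequent_holds_size_pos: "sequent_holds S \<Longrightarrow> 0 < sequent_size S"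
proof (cases S)
  case (Sequent \<Gamma> \<Delta>)
  moreover assume "sequent_holds S"
  ultimately obtain A where "A \<in># \<Gamma> + \<Delta>" by auto
  then obtain M where "\<Gamma> + \<Delta> = add_mset A M" by (metis multi_member_split)
  then show ?thesis by (simp add: Sequent sequent_size_def formula_size_pos)
qed

text \<open>Empty sequents would be lines of size 0; truth excludes them, so each line contributes
  at least 1.\<close>

lemma length_le_proof_size:
  "(\<And>S. S \<in> set \<pi> \<Longrightarrow> sequent_holds S) \<Longrightarrow> length \<pi> \<le> proof_size \<pi>"
  by (induction \<pi>) (fastforce simp: proof_size_def dest: sequent_holds_size_pos)+

lemma sequent_size_le_proof_size: "S \<in> set \<pi> \<Longrightarrow> sequent_size S \<le> proof_size \<pi>"
  by (auto simp: proof_size_def intro!: member_le_sum_list)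

lemma bounded_proof_size:
  "(\<And>S. S \<in> set \<pi> \<Longrightarrow> sequent_size S \<le> w) \<Longrightarrow> proof_size \<pi> \<le> length \<pi> * w"
  by (induction \<pi>) (auto simp: proof_size_def intro: add_mono)

text \<open>The factors are n original lines, 200w^3 new lines for each, and size at most w for each
  of these, where w = 20n^2. The degree is 9.\<close>

definition nf_bound :: "nat poly" where
  "nf_bound = [:0, 1:] * (200 * [:0, 0, 20:] ^ 3 * [:0, 0, 20:])"

lemma poly_nf_bound: "w = 20 * n\<^sup>2 \<Longrightarrow> poly nf_bound n = n * (200 * w ^ 3 * w)"
  by (simp add: nf_bound_def power2_eq_square ac_simps)

subsection \<open>Dag-like proofs\<close>

text \<open>Dropping nonemptiness and the end sequent from \<open>LNDT_proof\<close> makes the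
  notion closed under prefixes and suited to induction from the right.\<close>

definition LNDT_sequence :: "sequent list \<Rightarrow> bool" where
  "LNDT_sequence \<pi> \<longleftrightarrow>
     (\<forall>i<length \<pi>. \<exists>Ps. set Ps \<subseteq> set (take i \<pi>) \<and> LNDT_inference Ps (\<pi> ! i))"

lemma LNDT_sequence_Nil [simp]: "LNDT_sequence []"
  by (simp add: LNDT_sequence_def)

lemma LNDT_sequence_snoc [simp]:
  "LNDT_sequence (\<pi> @ [S]) \<longleftrightarrow>
     LNDT_sequence \<pi> \<and> (\<exists>Ps. set Ps \<subseteq> set \<pi> \<and> LNDT_inference Ps S)"
  by (auto simp: LNDT_sequence_def less_Suc_eq nth_append)

lemma LNDT_sequence_take: "LNDT_sequence \<pi> \<Longrightarrow> LNDT_sequence (take i \<pi>)"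
  by (auto simp: LNDT_sequence_def)

lemma LNDT_sequence_sound: "LNDT_sequence \<pi> \<Longrightarrow> S \<in> set \<pi> \<Longrightarrow> sequent_holds S"
  by (induction \<pi> arbitrary: S rule: rev_induct) (auto dest!: LNDT_inference_sound)

text \<open>The premises are already lines of \<pi>, so only the further lines of the derivation are
  appended.\<close>

lemma derivation_sequence:
  assumes "derivation w Ps S k" "set Ps \<subseteq> set \<pi>" "LNDT_sequence \<pi>"
  shows "\<exists>\<rho>. LNDT_sequence (\<pi> @ \<rho>) \<and> S \<in> set (\<pi> @ \<rho>) \<and> (\<forall>T\<in>set \<rho>. bounded_nf w T) \<and>
    length \<rho> \<le> k"
  using assms
proof (induction arbitrary: \<pi>)
  case (premise S k)
  then show ?case by (intro exI[of _ "[]"]) auto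
next
  case (axiom S k)
  then show ?case by (intro exI[of _ "[S]"]) (auto intro!: exI[of _ "[]"])
next
  case (unary T S Ps k l)
  from unary.IH[OF unary.prems] obtain \<rho> where
    "LNDT_sequence (\<pi> @ \<rho>)" "T \<in> set (\<pi> @ \<rho>)" "\<forall>T\<in>set \<rho>. bounded_nf w T" "length \<rho> \<le> k"
    by blast
  with unary.hyps show ?case
    using LNDT_sequence_snoc[of "\<pi> @ \<rho>" S]
    by (intro exI[of _ "\<rho> @ [S]"]) (auto intro!: exI[of _ "[T]"])
next
  case (binary T U S Ps k Qs l m)
  from binary.IH(1)[of \<pi>] binary.prems obtain \<rho> where \<rho>:
    "LNDT_sequence (\<pi> @ \<rho>)" "T \<in> set (\<pi> @ \<rho>)" "\<forall>T\<in>set \<rho>. bounded_nf w T" "length \<rho> \<le> k"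
    by auto
  \<comment> \<open>The second subderivation is appended after the first, which is why the induction
    generalizes over \<pi>.\<close>
  from binary.IH(2)[of "\<pi> @ \<rho>"] binary.prems \<rho>(1) obtain \<sigma> where \<sigma>:
    "LNDT_sequence (\<pi> @ \<rho> @ \<sigma>)" "U \<in> set (\<pi> @ \<rho> @ \<sigma>)" "\<forall>T\<in>set \<sigma>. bounded_nf w T" "length \<sigma> \<le> l"
    by auto
  with \<rho> binary.hyps show ?case
    using LNDT_sequence_snoc[of "\<pi> @ \<rho> @ \<sigma>" S]
    by (intro exI[of _ "\<rho> @ \<sigma> @ [S]"]) (auto intro!: exI[of _ "[T, U]"])
qed

lemma LNDT_sequence_nf:
  assumes "LNDT_sequence \<pi>" "\<And>S. S \<in> set \<pi> \<Longrightarrow> sequent_size S \<le> n" "0 < n" "w = 20 * n\<^sup>2"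
  shows "\<exists>\<pi>'. LNDT_sequence \<pi>' \<and> nf_sequent ` set \<pi> \<subseteq> set \<pi>' \<and> (\<forall>T\<in>set \<pi>'. bounded_nf w T) \<and>
    length \<pi>' \<le> length \<pi> * (200 * w ^ 3)"
  using assms(1,2)
proof (induction \<pi> rule: rev_induct)
  case Nil
  then show ?case by (intro exI[of _ "[]"]) auto
next
  case (snoc S \<pi>)
  then obtain \<pi>' where \<pi>': "LNDT_sequence \<pi>'" "nf_sequent ` set \<pi> \<subseteq> set \<pi>'"
    "\<forall>T\<in>set \<pi>'. bounded_nf w T" "length \<pi>' \<le> length \<pi> * (200 * w ^ 3)"
    by auto
  from snoc.prems(1) obtain Ps where Ps: "set Ps \<subseteq> set \<pi>" "LNDT_inference Ps S"
    by auto
  then have "derivation w (map nf_sequent Ps) (nf_sequent S) (200 * w ^ 3)"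
    using snoc.prems(2) assms(3,4) by (intro derivation_nf_sequent[where n=n]) auto
  moreover have "set (map nf_sequent Ps) \<subseteq> set \<pi>'"
    using Ps(1) \<pi>'(2) by auto
  ultimately obtain \<rho> where "LNDT_sequence (\<pi>' @ \<rho>)" "nf_sequent S \<in> set (\<pi>' @ \<rho>)"
    "\<forall>T\<in>set \<rho>. bounded_nf w T" "length \<rho> \<le> 200 * w ^ 3"
    using derivation_sequence \<pi>'(1) by meson
  with \<pi>' show ?case
    by (intro exI[of _ "\<pi>' @ \<rho>"]) auto
qed

lemma LNDT_proof_nf:
  assumes "normal_form_sequent S" "LNDT_proof \<pi> S"
  shows "\<exists>\<pi>'. LNDT_NF_proof \<pi>' S \<and> proof_size \<pi>' \<le> poly nf_bound (proof_size \<pi>)"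
proof -
  define n where "n = proof_size \<pi>"
  define w where "w = 20 * n\<^sup>2"
  from assms(2) have \<pi>: "LNDT_sequence \<pi>" "\<pi> \<noteq> []" "last \<pi> = S"
    by (auto simp: LNDT_proof_def LNDT_sequence_def)
  have len: "length \<pi> \<le> n"
    unfolding n_def using LNDT_sequence_sound[OF \<pi>(1)] by (rule length_le_proof_size)
  with \<pi>(2) have "0 < n" by (cases \<pi>) auto
  then obtain \<pi>' where \<pi>': "LNDT_sequence \<pi>'" "nf_sequent ` set \<pi> \<subseteq> set \<pi>'"
    "\<forall>T\<in>set \<pi>'. bounded_nf w T" "length \<pi>' \<le> length \<pi> * (200 * w ^ 3)"
    using LNDT_sequence_nf[OF \<pi>(1), of n w] sequent_size_le_proof_size[of _ \<pi>]
    by (auto simp: n_def w_def)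
  have "S \<in> set \<pi>'"
    using last_in_set[OF \<pi>(2)] \<pi>(3) \<pi>'(2) nf_sequent_normal_form[OF assms(1)] by force
  \<comment> \<open>\<open>S\<close> is known to occur, but not as the last line; the sequence is
    cut off after an occurrence.\<close>
  then obtain i where i: "i < length \<pi>'" "\<pi>' ! i = S"
    by (auto simp: in_set_conv_nth)
  let ?\<rho> = "take (Suc i) \<pi>'"
  have sub: "set ?\<rho> \<subseteq> set \<pi>'"
    by (rule set_take_subset)
  have "LNDT_NF_proof ?\<rho> S"
    using LNDT_sequence_take[OF \<pi>'(1), of "Suc i"] i sub \<pi>'(3)
    by (auto simp: LNDT_NF_proof_def LNDT_proof_def LNDT_sequence_def bounded_nf_def
        take_Suc_conv_app_nth)
  moreover have "proof_size ?\<rho> \<le> length ?\<rho> * w"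
    using sub \<pi>'(3) by (intro bounded_proof_size) (auto simp: bounded_nf_def)
  moreover have "length ?\<rho> * w \<le> n * (200 * w ^ 3) * w"
  proof (rule mult_right_mono)
    have "length ?\<rho> \<le> length \<pi>'" by simp
    also note \<pi>'(4)
    also have "length \<pi> * (200 * w ^ 3) \<le> n * (200 * w ^ 3)"
      using len by (rule mult_right_mono) simp
    finally show "length ?\<rho> \<le> n * (200 * w ^ 3)" .
  qed simp
  ultimately have "LNDT_NF_proof ?\<rho> S \<and> proof_size ?\<rho> \<le> poly nf_bound n"
    unfolding poly_nf_bound[OF w_def] mult.assoc by (metis order_trans)
  then show ?thesis
    unfolding n_def by blast
qed

subsection \<open>Tree-like proofs\<close>

lemma root_in_tree_lines [simp]: "root t \<in> set (tree_lines t)"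
  by (cases t) auto

lemma LNDT_tree_sound: "LNDT_tree t \<Longrightarrow> S \<in> set (tree_lines t) \<Longrightarrow> sequent_holds S"
proof (induction t arbitrary: S)
  case (Node R ts)
  then have "sequent_holds T" if "t \<in> set ts" "T \<in> set (tree_lines t)" for t T
    using that by auto
  with Node.prems show ?case
    by (auto intro!: LNDT_inference_sound[of "map root ts" R])
qed

text \<open>Since each premise is used exactly once and in order, the trees \<open>ts\<close> are
  grafted without copying, and their sizes enter the bound once.\<close>

lemma derivation_tree:
  assumes "derivation w Ps S k" "map root ts = Ps" "\<forall>t\<in>set ts. LNDT_NF_tree_proof t (root t)"
  shows "\<exists>t. LNDT_NF_tree_proof t S \<and>
    proof_size (tree_lines t) \<le> k * w + (\<Sum>t\<leftarrow>ts. proof_size (tree_lines t))"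
  using assms
proof (induction arbitrary: ts)
  case (premise S k)
  then show ?case by auto
next
  case (axiom S k)
  then show ?case
    by (intro exI[of _ "Node S []"])
       (auto simp: LNDT_NF_tree_proof_def LNDT_tree_proof_def bounded_nf_def proof_size_def Suc_le_eq
         dest!: gr0_implies_Suc)
next
  case (unary T S Ps k l)
  from unary.IH[OF unary.prems] obtain t where t: "LNDT_NF_tree_proof t T"
    "proof_size (tree_lines t) \<le> k * w + (\<Sum>t\<leftarrow>ts. proof_size (tree_lines t))"
    by blast
  have "Suc k * w \<le> l * w"
    using unary.hyps by (intro mult_right_mono) auto
  with t unary.hyps show ?case
    by (intro exI[of _ "Node S [t]"])
       (auto simp: LNDT_NF_tree_proof_def LNDT_tree_proof_def bounded_nf_def proof_size_def)
next
  case (binary T U S Ps k Qs l m)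
  from binary.prems(1) obtain ts\<^sub>1 ts\<^sub>2 where ts: "ts = ts\<^sub>1 @ ts\<^sub>2" "map root ts\<^sub>1 = Ps" "map root ts\<^sub>2 = Qs"
    by (auto simp: map_eq_append_conv)
  obtain t where t: "LNDT_NF_tree_proof t T"
    "proof_size (tree_lines t) \<le> k * w + (\<Sum>t\<leftarrow>ts\<^sub>1. proof_size (tree_lines t))"
    using binary.IH(1)[OF ts(2)] binary.prems(2) ts(1) by auto
  obtain u where u: "LNDT_NF_tree_proof u U"
    "proof_size (tree_lines u) \<le> l * w + (\<Sum>t\<leftarrow>ts\<^sub>2. proof_size (tree_lines t))"
    using binary.IH(2)[OF ts(3)] binary.prems(2) ts(1) by auto
  have "Suc (k + l) * w \<le> m * w"
    using binary.hyps by (intro mult_right_mono) auto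
  with t u binary.hyps ts(1) show ?case
    by (intro exI[of _ "Node S [t, u]"])
       (auto simp: LNDT_NF_tree_proof_def LNDT_tree_proof_def bounded_nf_def proof_size_def
         algebra_simps)
qed

text \<open>Each node adds at most \<open>200 * w ^ 3\<close> lines of size at most \<open>w\<close>
  on top of its translated subtrees, so the cost is additive over the nodes.\<close>

lemma LNDT_tree_nf:
  assumes "LNDT_tree t" "\<And>S. S \<in> set (tree_lines t) \<Longrightarrow> sequent_size S \<le> n" "0 < n" "w = 20 * n\<^sup>2"
  shows "\<exists>t'. LNDT_NF_tree_proof t' (nf_sequent (root t)) \<and>
    proof_size (tree_lines t') \<le> length (tree_lines t) * (200 * w ^ 3 * w)"
  using assms(1,2)
proof (induction t)
  case (Node S ts)
  let ?K = "200 * w ^ 3 * w"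
  have "\<forall>t\<in>set ts. \<exists>t'. LNDT_NF_tree_proof t' (nf_sequent (root t)) \<and>
    proof_size (tree_lines t') \<le> length (tree_lines t) * ?K"
    using Node by auto
  then obtain f where f: "\<forall>t\<in>set ts. LNDT_NF_tree_proof (f t) (nf_sequent (root t)) \<and>
    proof_size (tree_lines (f t)) \<le> length (tree_lines t) * ?K"
    by metis
  then have root: "\<forall>t\<in>set ts. root (f t) = nf_sequent (root t)"
    by (auto simp: LNDT_NF_tree_proof_def LNDT_tree_proof_def)
  have "derivation w (map nf_sequent (map root ts)) (nf_sequent S) (200 * w ^ 3)"
    using Node.prems root_in_tree_lines assms(3,4)
    by (intro derivation_nf_sequent[where n=n]) (auto simp del: root_in_tree_lines)
  from derivation_tree[OF this, of "map f ts"] root f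
  obtain t' where t': "LNDT_NF_tree_proof t' (nf_sequent S)"
    "proof_size (tree_lines t') \<le> ?K + (\<Sum>t\<leftarrow>ts. proof_size (tree_lines (f t)))"
    by (auto simp: comp_def)
  have "(\<Sum>t\<leftarrow>ts. proof_size (tree_lines (f t))) \<le> (\<Sum>t\<leftarrow>ts. length (tree_lines t) * ?K)"
    using f by (intro sum_list_mono) auto
  also have "\<dots> = length (concat (map tree_lines ts)) * ?K"
    by (simp add: length_concat sum_list_mult_const comp_def)
  finally show ?case
    using t' by (intro exI[of _ t']) auto
qed

lemma LNDT_tree_proof_nf:
  assumes "normal_form_sequent S" "LNDT_tree_proof t S"
  shows "\<exists>t'. LNDT_NF_tree_proof t' S \<and>
    proof_size (tree_lines t') \<le> poly nf_bound (proof_size (tree_lines t))"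
proof -
  define n where "n = proof_size (tree_lines t)"
  define w where "w = 20 * n\<^sup>2"
  from assms(2) have t: "LNDT_tree t" "root t = S"
    by (auto simp: LNDT_tree_proof_def)
  have len: "length (tree_lines t) \<le> n"
    unfolding n_def using LNDT_tree_sound[OF t(1)] by (rule length_le_proof_size)
  moreover have "0 < length (tree_lines t)"
    by (cases t) auto
  ultimately have "0 < n" by linarith
  then obtain t' where t': "LNDT_NF_tree_proof t' (nf_sequent S)"
    "proof_size (tree_lines t') \<le> length (tree_lines t) * (200 * w ^ 3 * w)"
    using LNDT_tree_nf[OF t(1), of n w] sequent_size_le_proof_size[of _ "tree_lines t"] t(2)
    by (auto simp: n_def w_def)
  have "length (tree_lines t) * (200 * w ^ 3 * w) \<le> poly nf_bound n"
    unfolding poly_nf_bound[OF w_def] using len by (intro mult_right_mono) auto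
  with t' nf_sequent_normal_form[OF assms(1)] show ?thesis
    by (auto simp: n_def)
qed

theorem theorem4p6:
  "(\<exists>P :: nat poly. \<forall>\<Gamma> \<Delta> \<pi>.
      normal_form_sequent (\<Gamma> \<turnstile> \<Delta>) \<longrightarrow> LNDT_proof \<pi> (\<Gamma> \<turnstile> \<Delta>) \<longrightarrow>
      (\<exists>\<pi>'. LNDT_NF_proof \<pi>' (\<Gamma> \<turnstile> \<Delta>) \<and>
            proof_size \<pi>' \<le> poly P (proof_size \<pi>))) \<and>
   (\<exists>P :: nat poly. \<forall>\<Gamma> \<Delta> t.
      normal_form_sequent (\<Gamma> \<turnstile> \<Delta>) \<longrightarrow> LNDT_tree_proof t (\<Gamma> \<turnstile> \<Delta>) \<longrightarrow>
      (\<exists>t'. LNDT_NF_tree_proof t' (\<Gamma> \<turnstile> \<Delta>) \<and>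
            proof_size (tree_lines t') \<le> poly P (proof_size (tree_lines t))))"
  using LNDT_proof_nf LNDT_tree_proof_nf by meson

end
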